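(* Let $n\ge1$ and $b_1,b_2,b_3\in\Delta_n$. If $P(b_1),P(b_2),P(b_3)$ form a nondegenerate equilateral triangle, then the three tiles labelled by $b_1,b_2,b_3$ have the same orientation. Equivalently, $$b_1^2=b_2^2=b_3^2 .$$
   Context: $\Delta_n=\{i,j,k,e\}^n$ is the set of words $b=b_1b_2\cdots b_n$ of length $n$ in the four symbols $i,j,k,e$. Put $v(i)=(\cos 210^\circ,\sin 210^\circ)$, $v(j)=(\cos 90^\circ,\sin 90^\circ)$, $v(k)=(\cos 330^\circ,\sin 330^\circ)$, $v(e)=(0,0)$ in $\mathbb R^2$. Fix a real $d_1>0$ and put $d_r=d_1/2^{r-1}$. The centroid map $P:\Delta_n\to\mathbb R^2$ is $$P(b)=\sum_{r=1}^n \sigma_r(b)\,d_r\,v(b_r),\qquad \sigma_r(b)=(-1)^{\#\{s<r:\ b_s=e\}}.$$ $P(b)$ is the centroid of the tile labelled $b$ in the $n$-fold recursive midpoint subdivision of an equilateral triangle. With $\nu(b)=\#\{r:\ b_r\ne e\}$, the tile labelled $b$ is upward if and only if $\nu(b)\equiv n\pmod 2$, and downward otherwise; this is its orientation. Multiplication: words of $\Delta_n$ are multiplied coordinatewise as quaternions ($e$ is the quaternion identity, $i^2=j^2=k^2=-e$, $ij=k$, $jk=i$, $ki=j$, distinct elements of $\{i,j,k\}$ anticommute), with the local signs collected into one global sign; the result lies in the group $F_n=\{\pm b: b\in\Delta_n\}$ with identity $e_n=ee\cdots e$. Thus $b^2=(-1)^{\nu(b)}e_n$. *)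

theory Defs
  imports "HOL-Analysis.Analysis"
begin

datatype letter = Qi | Qj | Qk | Qe

definition Delta :: "nat \<Rightarrow> letter list set" where
  "Delta n = {b. length b = n}"

definition unit_vec :: "real \<Rightarrow> real^2" where
  "unit_vec \<theta> = vector [cos \<theta>, sin \<theta>]"

text \<open>The angles are 210, 90 and 330 degrees.\<close>

fun vdir :: "letter \<Rightarrow> real^2" where
  "vdir Qi = unit_vec (7 * pi / 6)"
| "vdir Qj = unit_vec (pi / 2)"
| "vdir Qk = unit_vec (11 * pi / 6)"
| "vdir Qe = 0"

text \<open>
  Positions in a word are counted from 0, so the scale at position \<open>r\<close>,
  \<open>d1 / 2 ^ r\<close>, is what is written \<open>d_(r+1)\<close> when counting from 1.
\<close>

definition sigma :: "letter list \<Rightarrow> nat \<Rightarrow> real" where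
  "sigma b r = (- 1) ^ card {s. s < r \<and> b ! s = Qe}"

definition centroid :: "real \<Rightarrow> letter list \<Rightarrow> real^2" where
  "centroid d1 b = (\<Sum>r<length b. (sigma b r * (d1 / 2 ^ r)) *\<^sub>R vdir (b ! r))"

definition nu :: "letter list \<Rightarrow> nat" where
  "nu b = card {r. r < length b \<and> b ! r \<noteq> Qe}"

datatype orientation = Upward | Downward

text \<open>
  The tile labelled \<open>b\<close> enters only through its centroid and through its orientation,
  which is read off the label.
\<close>

definition tile_orientation :: "letter list \<Rightarrow> orientation" where
  "tile_orientation b = (if nu b mod 2 = length b mod 2 then Upward else Downward)"

definition nondegenerate_equilateral :: "real^2 \<Rightarrow> real^2 \<Rightarrow> real^2 \<Rightarrow> bool" where
  "nondegenerate_equilateral A B C \<longleftrightarrow>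
     dist A B = dist B C \<and> dist B C = dist C A \<and> \<not> collinear {A, B, C}"

text \<open>
  A signed letter \<open>(s, x)\<close> or signed word \<open>(s, b)\<close>, with \<open>s\<close> being 1 or -1,
  stands for \<open>s x\<close> or \<open>s b\<close>.
\<close>

fun letter_mult :: "letter \<Rightarrow> letter \<Rightarrow> int \<times> letter" where
  "letter_mult Qe y = (1, y)"
| "letter_mult x Qe = (1, x)"
| "letter_mult Qi Qi = (-1, Qe)"
| "letter_mult Qj Qj = (-1, Qe)"
| "letter_mult Qk Qk = (-1, Qe)"
| "letter_mult Qi Qj = (1, Qk)"
| "letter_mult Qj Qk = (1, Qi)"
| "letter_mult Qk Qi = (1, Qj)"
| "letter_mult Qj Qi = (-1, Qk)"
| "letter_mult Qk Qj = (-1, Qi)"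
| "letter_mult Qi Qk = (-1, Qj)"

type_synonym signed_word = "int \<times> letter list"

fun word_mult :: "signed_word \<Rightarrow> signed_word \<Rightarrow> signed_word" where
  "word_mult (s, a) (t, b) =
     (s * t * prod_list (map2 (\<lambda>x y. fst (letter_mult x y)) a b),
      map2 (\<lambda>x y. snd (letter_mult x y)) a b)"

definition word_square :: "letter list \<Rightarrow> signed_word" where
  "word_square b = word_mult (1, b) (1, b)"

end

theory Submission
  imports Defs
begin

text \<open>
  In units of \<open>d1 / 2 ^ n\<close>, the centroid of every tile of level \<open>n\<close> has the form
  \<open>(sqrt 3 * u, w)\<close> with integers \<open>u\<close> and \<open>w\<close>, so the squared distance of two centroids is
  \<open>3 * (u - u')\<^sup>2 + (w - w')\<^sup>2\<close>, which is congruent to \<open>(w - w')\<^sup>2\<close> modulo 3.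

  Modulo 3 the height \<open>w\<close> knows the orientation. The three directions \<open>i\<close>, \<open>j\<close>, \<open>k\<close> all have the
  same height modulo 3, and the scale \<open>2\<close> is \<open>-1\<close>; so a letter different from \<open>e\<close> contributes
  one fixed sign times \<open>(-1) ^ m\<close>, where \<open>m\<close> is the number of earlier letters different
  from \<open>e\<close>. The sum \<open>1 - 1 + 1 - ...\<close> with \<open>nu b\<close> terms is \<open>0\<close> or \<open>1\<close>
  according to the parity of \<open>nu b\<close> (\<open>centroid_lattice_coordinates\<close>).

  Hence the scaled squared distance of two centroids is divisible by 3 exactly when the tiles have
  the same orientation (\<open>same_parity_iff_dist_dvd\<close>). If the three distances coincide, then
  either all three pairs of tiles agree in orientation or all three pairs disagree. The latter is
  impossible, because there are only two orientations.
\<close>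

section \<open>Recursion over words\<close>

lemma nu_Nil: "nu [] = 0"
  by (simp add: nu_def)

lemma nu_Cons: "nu (x # b) = (if x = Qe then nu b else Suc (nu b))"
proof -
  have "nu b = length (filter (\<lambda>y. y \<noteq> Qe) b)" for b
    by (simp add: nu_def length_filter_conv_card)
  then show ?thesis by simp
qed

lemma sigma_0: "sigma b 0 = 1"
  by (simp add: sigma_def)

lemma sigma_Cons_Suc: "sigma (x # b) (Suc r) = (if x = Qe then - sigma b r else sigma b r)"
proof -
  let ?A = "{s. s < r \<and> b ! s = Qe}"
  have "{s. s < Suc r \<and> (x # b) ! s = Qe} = (if x = Qe then insert 0 (Suc ` ?A) else Suc ` ?A)"
    by (auto simp: less_Suc_eq_0_disj image_iff)
  then show ?thesis
    by (simp add: sigma_def card_image)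
qed

lemma centroid_Cons:
  "centroid d (x # b) = d *\<^sub>R vdir x + (if x = Qe then - 1 else 1) *\<^sub>R centroid (d / 2) b"
  unfolding centroid_def length_Cons sum.lessThan_Suc_shift scaleR_sum_right
  by (auto simp: sigma_0 sigma_Cons_Suc intro!: sum.cong)

section \<open>Orientation as a residue modulo 3\<close>

text \<open>
  The directions lie in the lattice of points \<open>(sqrt 3 / 2 * u, w / 2)\<close>, and those of
  \<open>i\<close>, \<open>j\<close>, \<open>k\<close> cannot be told apart by the residue of \<open>w\<close>.
\<close>

lemma vdir_lattice_coordinates:
  obtains u w :: int where "vdir x = vector [sqrt 3 / 2 * u, w / 2]"
    and "3 dvd w + of_bool (x \<noteq> Qe)"
proof -
  have i: "7 * pi / 6 = pi / 6 + pi" and k: "11 * pi / 6 = 2 * pi - pi / 6"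
    by simp_all
  show ?thesis
  proof (cases x)
    case Qi
    then have "vdir x = vector [sqrt 3 / 2 * of_int (- 1), of_int (- 1) / 2]"
      unfolding Qi vdir.simps unit_vec_def i cos_periodic_pi sin_periodic_pi
      by (simp add: cos_30 sin_30)
    then show ?thesis by (rule that) (simp add: Qi)
  next
    case Qj
    then have "vdir x = vector [sqrt 3 / 2 * of_int 0, of_int 2 / 2]"
      by (simp add: unit_vec_def)
    then show ?thesis by (rule that) (simp add: Qj)
  next
    case Qk
    then have "vdir x = vector [sqrt 3 / 2 * of_int 1, of_int (- 1) / 2]"
      unfolding Qk vdir.simps unit_vec_def k cos_2pi_minus sin_2pi_minus
      by (simp add: cos_30 sin_30)
    then show ?thesis by (rule that) (simp add: Qk)
  next
    case Qe
    then have "vdir x = vector [sqrt 3 / 2 * of_int 0, of_int 0 / 2]"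
      by (simp add: vec_eq_iff forall_2 vector_2)
    then show ?thesis by (rule that) (simp add: Qe)
  qed
qed

lemma three_dvd_power_two_minus: "(3::int) dvd 2 ^ n - (- 1) ^ n"
  by (induction n) (simp, simp, presburger)

text \<open>
  Prefixing a letter moves the rest of the word one scale down. Modulo 3 the new letter then adds
  \<open>(-1) ^ Suc n\<close> when it is not \<open>e\<close>, and otherwise reverses the sign of the rest; both agree with
  the claimed residue, which vanishes exactly for even \<open>nu b\<close>.
\<close>

lemma centroid_lattice_coordinates:
  obtains u w :: int where
    "centroid d b = vector [d / 2 ^ length b * (sqrt 3 * u), d / 2 ^ length b * w]"
    and "3 dvd w - (- 1) ^ length b * of_bool (odd (nu b))"
proof -
  have "\<exists>(u :: int) (w :: int).
      centroid d b = vector [d / 2 ^ length b * (sqrt 3 * u), d / 2 ^ length b * w] \<and>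
      (3 :: int) dvd w - (- 1) ^ length b * of_bool (odd (nu b))"
  proof (induction b arbitrary: d)
    case Nil
    have "centroid d [] = vector [d / 2 ^ length [] * (sqrt 3 * of_int 0), d / 2 ^ length [] * of_int 0]"
      by (simp add: centroid_def vec_eq_iff forall_2 vector_2)
    then show ?case
      by (intro exI[of _ 0]) (simp add: nu_Nil)
  next
    case (Cons x b)
    let ?n = "length b"
    obtain u w :: int where
      tail: "centroid (d / 2) b = vector [d / 2 / 2 ^ ?n * (sqrt 3 * u), d / 2 / 2 ^ ?n * w]"
      and w: "3 dvd w - (- 1) ^ ?n * of_bool (odd (nu b))"
      using Cons.IH[of "d / 2"] by blast
    obtain p q :: int where
      head: "vdir x = vector [sqrt 3 / 2 * p, q / 2]" and q: "3 dvd q + of_bool (x \<noteq> Qe)"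
      by (rule vdir_lattice_coordinates)
    define s :: int where "s = (if x = Qe then - 1 else 1)"
    define u' w' where "u' = 2 ^ ?n * p + s * u" and "w' = 2 ^ ?n * q + s * w"
    have "centroid d (x # b) = d *\<^sub>R vdir x + of_int s *\<^sub>R centroid (d / 2) b"
      by (simp add: centroid_Cons s_def)
    also have "\<dots> = vector [d / 2 ^ length (x # b) * (sqrt 3 * u'), d / 2 ^ length (x # b) * w']"
      unfolding tail head u'_def w'_def
      by (simp add: vec_eq_iff forall_2 vector_2 field_simps)
    finally have coords: "centroid d (x # b) =
        vector [d / 2 ^ length (x # b) * (sqrt 3 * u'), d / 2 ^ length (x # b) * w']" .
    have "w' - (- 1) ^ length (x # b) * of_bool (odd (nu (x # b))) =
        2 ^ ?n * (q + of_bool (x \<noteq> Qe)) - of_bool (x \<noteq> Qe) * (2 ^ ?n - (- 1) ^ ?n)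
        + s * (w - (- 1) ^ ?n * of_bool (odd (nu b)))"
      by (simp add: w'_def s_def nu_Cons algebra_simps)
    also have "3 dvd \<dots>"
      by (intro dvd_add dvd_diff dvd_mult q w three_dvd_power_two_minus)
    finally show ?case using coords by blast
  qed
  then show ?thesis using that by blast
qed

text \<open>
  The term \<open>3 * (u - u')\<^sup>2\<close> of the squared distance vanishes modulo 3, and the heights of two words
  of equal length differ, modulo 3, by \<open>0\<close> or \<open>\<plusminus>1\<close> according to whether the parities of
  \<open>nu\<close> agree.
\<close>

lemma same_parity_iff_dist_dvd:
  assumes "length a = length b"
  obtains D :: int where
    "(dist (centroid d a) (centroid d b))\<^sup>2 = (d / 2 ^ length b)\<^sup>2 * D"
    and "3 dvd D \<longleftrightarrow> even (nu a) = even (nu b)"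
proof -
  let ?c = "d / 2 ^ length b" and ?e = "(- 1 :: int) ^ length b"
  obtain u w :: int where
    a: "centroid d a = vector [?c * (sqrt 3 * u), ?c * w]"
    and w: "3 dvd w - ?e * of_bool (odd (nu a))"
    using centroid_lattice_coordinates[of d a] unfolding assms by blast
  obtain u' w' :: int where
    b: "centroid d b = vector [?c * (sqrt 3 * u'), ?c * w']"
    and w': "3 dvd w' - ?e * of_bool (odd (nu b))"
    using centroid_lattice_coordinates[of d b] by blast
  define D where "D = 3 * (u - u')\<^sup>2 + (w - w')\<^sup>2"
  have "(dist (centroid d a) (centroid d b))\<^sup>2 =
      (?c * (sqrt 3 * u) - ?c * (sqrt 3 * u'))\<^sup>2 + (?c * w - ?c * w')\<^sup>2"
    unfolding a b by (simp add: dist_vec_def L2_set_def sum_2 vector_2 dist_real_def)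
  also have "\<dots> = ?c\<^sup>2 * ((sqrt 3)\<^sup>2 * (real_of_int u - u')\<^sup>2 + (real_of_int w - w')\<^sup>2)"
    by algebra
  also have "\<dots> = ?c\<^sup>2 * D"
    by (simp add: D_def)
  finally have dist: "(dist (centroid d a) (centroid d b))\<^sup>2 = ?c\<^sup>2 * D" .
  have "3 dvd D \<longleftrightarrow> 3 dvd (w - w')\<^sup>2"
    unfolding D_def by (rule dvd_add_right_iff) simp
  also have "\<dots> \<longleftrightarrow> 3 dvd w - w'"
    by (rule prime_dvd_power_iff) auto
  also have "\<dots> \<longleftrightarrow> even (nu a) = even (nu b)"
  proof -
    let ?t = "of_bool (odd (nu a)) - of_bool (odd (nu b)) :: int"
    have "3 dvd (w - w') - ?e * ?t"
      using dvd_diff[OF w w'] by (simp add: algebra_simps)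
    then have "3 dvd w - w' \<longleftrightarrow> 3 dvd ?e * ?t"
      using dvd_add_right_iff[of 3 "(w - w') - ?e * ?t" "?e * ?t"] by simp
    also have "\<dots> \<longleftrightarrow> even (nu a) = even (nu b)"
      by (simp add: minus_one_power_iff)
    finally show ?thesis .
  qed
  finally show ?thesis using dist that by blast
qed

section \<open>Squares of words\<close>

lemma word_square_eq: "word_square b = ((- 1) ^ nu b, replicate (length b) Qe)"
proof (induction b)
  case Nil
  then show ?case by (simp add: word_square_def nu_Nil)
next
  case (Cons x b)
  then show ?case
    by (cases x) (simp_all add: word_square_def nu_Cons)
qed

lemma word_square_eq_iff:
  "length a = length b \<Longrightarrow> word_square a = word_square b \<longleftrightarrow> even (nu a) = even (nu b)"
  by (simp add: word_square_eq minus_one_power_iff)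

lemma tile_orientation_eq_iff:
  "length a = length b \<Longrightarrow>
    tile_orientation a = tile_orientation b \<longleftrightarrow> even (nu a) = even (nu b)"
  by (simp add: tile_orientation_def mod2_eq_if)

section \<open>Equilateral triangles of centroids\<close>

theorem theorem3p5:
  fixes n :: nat and d1 :: real and b1 b2 b3 :: "letter list"
  assumes "n \<ge> 1" and "d1 > 0"
    and "b1 \<in> Delta n" and "b2 \<in> Delta n" and "b3 \<in> Delta n"
  shows "(nondegenerate_equilateral (centroid d1 b1) (centroid d1 b2) (centroid d1 b3) \<longrightarrow>
           tile_orientation b1 = tile_orientation b2 \<and> tile_orientation b2 = tile_orientation b3 \<and>
           word_square b1 = word_square b2 \<and> word_square b2 = word_square b3) \<and>
         (tile_orientation b1 = tile_orientation b2 \<and> tile_orientation b2 = tile_orientation b3 \<longleftrightarrow>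
           word_square b1 = word_square b2 \<and> word_square b2 = word_square b3)"
proof -
  have len: "length b1 = n" "length b2 = n" "length b3 = n"
    using assms by (auto simp: Delta_def)
  have parity: "even (nu b1) = even (nu b2) \<and> even (nu b2) = even (nu b3)"
    if "nondegenerate_equilateral (centroid d1 b1) (centroid d1 b2) (centroid d1 b3)"
  proof -
    have eq: "dist (centroid d1 b1) (centroid d1 b2) = dist (centroid d1 b2) (centroid d1 b3)"
      "dist (centroid d1 b2) (centroid d1 b3) = dist (centroid d1 b3) (centroid d1 b1)"
      using that by (auto simp: nondegenerate_equilateral_def)
    obtain D12 :: int where
      D12: "(dist (centroid d1 b1) (centroid d1 b2))\<^sup>2 = (d1 / 2 ^ n)\<^sup>2 * D12"
        "3 dvd D12 \<longleftrightarrow> even (nu b1) = even (nu b2)"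
      using same_parity_iff_dist_dvd[of b1 b2 d1] len by auto
    obtain D23 :: int where
      D23: "(dist (centroid d1 b2) (centroid d1 b3))\<^sup>2 = (d1 / 2 ^ n)\<^sup>2 * D23"
        "3 dvd D23 \<longleftrightarrow> even (nu b2) = even (nu b3)"
      using same_parity_iff_dist_dvd[of b2 b3 d1] len by auto
    obtain D31 :: int where
      D31: "(dist (centroid d1 b3) (centroid d1 b1))\<^sup>2 = (d1 / 2 ^ n)\<^sup>2 * D31"
        "3 dvd D31 \<longleftrightarrow> even (nu b3) = even (nu b1)"
      using same_parity_iff_dist_dvd[of b3 b1 d1] len by auto
    have "d1 / 2 ^ n \<noteq> 0"
      using \<open>d1 > 0\<close> by simp
    then have "D12 = D23" "D23 = D31"
      using eq D12(1) D23(1) D31(1) by auto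
    then show ?thesis
      using D12(2) D23(2) D31(2) by metis
  qed
  show ?thesis
    using parity by (simp add: len tile_orientation_eq_iff word_square_eq_iff)
qed

end
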